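(* Let $a=a_1,a_2,\ldots,a_n$ be a feasible sequence. Form the sequence $\hat a=\hat a_2,\hat a_3,\ldots,\hat a_n$ (indexed by $2,\dots,n$) by deleting $a_1$ and adding $1$ to each of the $a_1$ smallest elements among $a_2,\ldots,a_n$ (leaving the other entries unchanged), where $a_i$ is considered smaller than $a_j$ if $a_i<a_j$, or if $a_i=a_j$ and $i<j$. Then $\hat a$ is well defined (i.e. $0\le a_1\le n-1$) and is feasible, that is: $\hat a$ is non-increasing, $\sum_{i=2}^n \hat a_i=0$, and $\sum_{i=2}^k \hat a_i\le (k-1)(n-k)$ for all $2\le k\le n$.
   Context: A non-increasing sequence of integers $c=c_1,c_2,\ldots,c_N$ is called feasible if $\sum_{i=1}^N c_i=0$ and $\sum_{i=1}^k c_i\le k(N-k)$ for all $1\le k\le N$. (For the sequence $\hat a$ of length $N=n-1$ indexed from $2$ to $n$, this is the condition stated in the claim.) *)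

theory Defs
  imports Complex_Main
begin

text \<open>A sequence \<open>c\<^sub>1, \<dots>, c\<^sub>N\<close> is a function on \<open>nat\<close>, of which only the values on \<open>{1..N}\<close> matter.\<close>

definition feasible :: "nat \<Rightarrow> (nat \<Rightarrow> int) \<Rightarrow> bool" where
  "feasible N c \<longleftrightarrow>
     antimono_on {1..N} c \<and>
     (\<Sum>i=1..N. c i) = 0 \<and>
     (\<forall>k\<in>{1..N}. (\<Sum>i=1..k. c i) \<le> int k * (int N - int k))"

definition smaller :: "(nat \<Rightarrow> int) \<Rightarrow> nat \<Rightarrow> nat \<Rightarrow> bool" where
  "smaller a i j \<longleftrightarrow> a i < a j \<or> (a i = a j \<and> i < j)"

text \<open>The positions in \<open>A\<close> of the \<open>m\<close> smallest elements: those with fewer than \<open>m\<close> elements below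
  them. The two lemmas below confirm that, if \<open>m \<le> card A\<close>, there are exactly \<open>m\<close> such positions and
  that their elements are smaller than all the remaining ones.\<close>

definition smallest :: "(nat \<Rightarrow> int) \<Rightarrow> nat set \<Rightarrow> nat \<Rightarrow> nat set" where
  "smallest a A m = {i \<in> A. card {j \<in> A. smaller a j i} < m}"

lemma smaller_rank_less:
  assumes "finite A" "i \<in> A" "smaller a i j"
  shows "card {l \<in> A. smaller a l i} < card {l \<in> A. smaller a l j}"
proof (rule psubset_card_mono)
  show "finite {l \<in> A. smaller a l j}" using assms by simp
  have "{l \<in> A. smaller a l i} \<subseteq> {l \<in> A. smaller a l j}"
    using assms by (auto simp: smaller_def)
  moreover have "i \<in> {l \<in> A. smaller a l j}" "i \<notin> {l \<in> A. smaller a l i}"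
    using assms by (auto simp: smaller_def)
  ultimately show "{l \<in> A. smaller a l i} \<subset> {l \<in> A. smaller a l j}" by blast
qed

lemma smallest_smaller:
  assumes "finite A" "i \<in> smallest a A m" "j \<in> A - smallest a A m"
  shows "smaller a i j"
proof (rule ccontr)
  assume "\<not> smaller a i j"
  then have "smaller a j i \<or> i = j" by (auto simp: smaller_def)
  then show False
    using assms smaller_rank_less[of A j a i] by (auto simp: smallest_def)
qed

lemma card_smallest:
  assumes "finite A" "m \<le> card A"
  shows "card (smallest a A m) = m"
proof -
  define r where "r i = card {j \<in> A. smaller a j i}" for i
  have inj: "inj_on r A"
  proof (rule inj_onI)
    fix i j assume ij: "i \<in> A" "j \<in> A" "r i = r j"
    have "smaller a i j \<or> smaller a j i \<or> i = j" by (auto simp: smaller_def)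
    then show "i = j"
      using ij smaller_rank_less[OF assms(1), of i a j] smaller_rank_less[OF assms(1), of j a i]
      unfolding r_def by linarith
  qed
  have "r i < card A" if "i \<in> A" for i
    unfolding r_def
  proof (rule psubset_card_mono[OF assms(1)])
    have "i \<notin> {j \<in> A. smaller a j i}" by (simp add: smaller_def)
    then show "{j \<in> A. smaller a j i} \<subset> A" using that by blast
  qed
  then have "r ` A \<subseteq> {..<card A}" by auto
  then have im: "r ` A = {..<card A}"
    using card_image[OF inj] by (intro card_subset_eq) auto
  have "r ` smallest a A m = {..<m}"
  proof
    show "r ` smallest a A m \<subseteq> {..<m}" by (auto simp: smallest_def r_def)
    show "{..<m} \<subseteq> r ` smallest a A m"
    proof
      fix x assume x: "x \<in> {..<m}"
      then have "x \<in> r ` A" using im assms(2) by auto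
      then obtain i where "i \<in> A" "x = r i" by blast
      then show "x \<in> r ` smallest a A m" using x by (auto simp: smallest_def r_def)
    qed
  qed
  moreover have "inj_on r (smallest a A m)"
    by (rule inj_on_subset[OF inj]) (auto simp: smallest_def)
  ultimately show ?thesis using card_image[of r "smallest a A m"] by simp
qed

text \<open>Only the values on \<open>{2..n}\<close> matter; meaningful when \<open>0 \<le> a 1 \<le> n - 1\<close>.\<close>

definition hat :: "nat \<Rightarrow> (nat \<Rightarrow> int) \<Rightarrow> nat \<Rightarrow> int" where
  "hat n a i = (if i \<in> smallest a {2..n} (nat (a 1)) then a i + 1 else a i)"

end

theory Submission
  imports Defs
begin

text \<open>If the increased positions all lie to the right of \<open>k\<close>, or include everything to the right
  of \<open>k\<close>, the bound at \<open>k\<close> follows directly from the feasibility of \<open>a\<close>. Otherwise some position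
  \<open>i \<le> k\<close> is increased while some \<open>j > k\<close> is not, which forces \<open>a\<close> to be constant on \<open>{i..j}\<close>, so
  \<open>hat n a\<close> drops by at most 1 from \<open>k\<close> to \<open>k + 1\<close>. As the increments of \<open>(k - 1) (n - k)\<close> drop
  by 2, the slack in the bound is strictly concave at \<open>k\<close> and thus has no minimum there.\<close>

lemma nonneg_if_strictly_concave_where_neg:
  fixes f :: "nat \<Rightarrow> 'a :: linordered_ab_group_add"
  assumes concave: "\<And>k. k \<in> {m..n} \<Longrightarrow> f k < 0 \<Longrightarrow>
      m < k \<and> k < n \<and> f (Suc k) - f k < f k - f (k - 1)"
    and "k \<in> {m..n}"
  shows "0 \<le> f k"
proof (rule ccontr)
  assume "\<not> 0 \<le> f k"
  obtain l where l: "l \<in> {m..n}" and min: "\<And>i. i \<in> {m..n} \<Longrightarrow> f l \<le> f i"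
    using ex_is_arg_min_if_finite[of "{m..n}" f] \<open>k \<in> {m..n}\<close>
    by (auto simp: is_arg_min_linorder)
  have "f l < 0"
    using min[OF \<open>k \<in> {m..n}\<close>] \<open>\<not> 0 \<le> f k\<close> by simp
  then have "m < l" "l < n" and drop: "f (Suc l) - f l < f l - f (l - 1)"
    using concave[OF l] by auto
  have "0 \<le> f (Suc l) - f l"
    using min[of "Suc l"] \<open>m < l\<close> \<open>l < n\<close> by simp
  also note drop
  also have "f l - f (l - 1) \<le> 0"
    using min[of "l - 1"] \<open>m < l\<close> \<open>l < n\<close> by (auto simp: Suc_leI less_imp_le)
  finally show False by simp
qed

lemma antimono_on_constant_between_smallest:
  assumes "finite A" "antimono_on A a"
    and "i \<in> smallest a A m" "j \<in> A - smallest a A m"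
    and "x \<in> A" "i \<le> x" "x \<le> j"
  shows "a x = a i"
proof (rule antisym)
  have "i \<in> A" using assms(3) by (simp add: smallest_def)
  then show "a x \<le> a i" using assms by (auto simp: monotone_on_def)
  have "a i \<le> a j"
    using smallest_smaller[OF assms(1,3,4)] by (auto simp: smaller_def)
  also have "a j \<le> a x" using assms by (auto simp: monotone_on_def)
  finally show "a i \<le> a x" .
qed

lemma antimono_on_increment_smallest:
  assumes "finite A" "antimono_on A a"
  shows "antimono_on A (\<lambda>i. a i + of_bool (i \<in> smallest a A m))"
proof (rule monotone_onI)
  fix i j assume ij: "i \<in> A" "j \<in> A" "i \<le> j"
  have "a j \<le> a i" using assms(2) ij by (auto simp: monotone_on_def)
  moreover have "a j < a i" if "j \<in> smallest a A m" "i \<notin> smallest a A m"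
    using smallest_smaller[OF assms(1), of j a m i] that ij by (auto simp: smaller_def)
  ultimately show "a i + of_bool (i \<in> smallest a A m) \<ge> a j + of_bool (j \<in> smallest a A m)"
    by auto
qed

lemma feasible_antimono_on_tail:
  assumes "feasible n a"
  shows "antimono_on {2..n} a"
  using assms by (auto simp: feasible_def intro: monotone_on_subset)

lemma feasible_le_first:
  assumes "feasible n a" "i \<in> {1..n}"
  shows "a i \<le> a 1"
  using assms by (auto simp: feasible_def monotone_on_def)

lemma feasible_first_nonneg:
  assumes "feasible n a" "n \<ge> 1"
  shows "0 \<le> a 1"
proof -
  have "(\<Sum>i=1..n. a i) \<le> of_nat (card {1..n}) * a 1"
    by (intro sum_bounded_above feasible_le_first[OF assms(1)])
  then show ?thesis
    using assms by (simp add: feasible_def zero_le_mult_iff)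
qed

lemma feasible_first_le:
  assumes "feasible n a" "n \<ge> 1"
  shows "a 1 \<le> int n - 1"
proof -
  have "(\<Sum>i=1..1. a i) \<le> int 1 * (int n - int 1)"
    using assms unfolding feasible_def by (metis atLeastAtMost_iff order_refl)
  then show ?thesis by simp
qed

lemma feasible_shift_iff:
  assumes "n \<ge> 1"
  shows "feasible (n - 1) (\<lambda>i. c (i + 1)) \<longleftrightarrow>
    antimono_on {2..n} c \<and> (\<Sum>i=2..n. c i) = 0 \<and>
    (\<forall>k\<in>{2..n}. (\<Sum>i=2..k. c i) \<le> (int k - 1) * (int n - int k))"
proof -
  obtain N where n: "n = Suc N" using assms by (cases n) auto
  have range: "{2..Suc N} = Suc ` {1..N}" by (simp add: numeral_2_eq_2)
  have sum: "(\<Sum>i=2..Suc k. c i) = (\<Sum>i=1..k. c (i + 1))" for k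
    using sum.shift_bounds_cl_Suc_ivl[of c 1 k] by (simp add: numeral_2_eq_2)
  have "antimono_on {2..Suc N} c \<longleftrightarrow> antimono_on {1..N} (\<lambda>i. c (i + 1))"
    unfolding range monotone_on_def by (simp del: image_Suc_atLeastAtMost)
  moreover have "(\<forall>k\<in>{2..Suc N}. (\<Sum>i=2..k. c i) \<le> (int k - 1) * (int (Suc N) - int k)) \<longleftrightarrow>
      (\<forall>k\<in>{1..N}. (\<Sum>i=1..k. c (i + 1)) \<le> int k * (int N - int k))"
    unfolding range by (simp add: sum del: image_Suc_atLeastAtMost sum.cl_ivl_Suc)
  ultimately show ?thesis by (simp add: n feasible_def sum del: sum.cl_ivl_Suc)
qed

abbreviation increased :: "nat \<Rightarrow> (nat \<Rightarrow> int) \<Rightarrow> nat set" where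
  "increased n a \<equiv> smallest a {2..n} (nat (a 1))"

lemma hat_eq: "hat n a = (\<lambda>i. a i + of_bool (i \<in> increased n a))"
  by (auto simp: hat_def)

lemma card_increased:
  assumes "feasible n a" "n \<ge> 1"
  shows "int (card (increased n a)) = a 1"
  using card_smallest[of "{2..n}" "nat (a 1)" a]
    feasible_first_nonneg[OF assms] feasible_first_le[OF assms] by simp

lemma antimono_on_hat:
  assumes "feasible n a"
  shows "antimono_on {2..n} (hat n a)"
  unfolding hat_eq
  by (intro antimono_on_increment_smallest feasible_antimono_on_tail assms) simp

lemma sum_hat_eq:
  assumes "feasible n a" "k \<in> {1..n}"
  shows "(\<Sum>i=2..k. hat n a i) = (\<Sum>i=1..k. a i) - int (card (increased n a \<inter> {k<..n}))"
proof -
  let ?S = "increased n a"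
  have "?S = (?S \<inter> {2..k}) \<union> (?S \<inter> {k<..n})"
    by (auto simp: smallest_def)
  then have "card ?S = card ((?S \<inter> {2..k}) \<union> (?S \<inter> {k<..n}))"
    by (rule arg_cong)
  also have "\<dots> = card (?S \<inter> {2..k}) + card (?S \<inter> {k<..n})"
    by (rule card_Un_disjoint) auto
  finally have "a 1 = int (card (?S \<inter> {2..k})) + int (card (?S \<inter> {k<..n}))"
    using card_increased[OF assms(1)] assms(2) by simp
  moreover have "(\<Sum>i=2..k. hat n a i) = (\<Sum>i=2..k. a i) + int (card (?S \<inter> {2..k}))"
    by (simp add: hat_eq sum.distrib sum_of_bool_eq Int_commute)
  moreover have "(\<Sum>i=1..k. a i) = a 1 + (\<Sum>i=2..k. a i)"
    using assms(2) by (simp add: sum.atLeast_Suc_atMost numeral_2_eq_2)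
  ultimately show ?thesis by simp
qed

lemma sum_hat_eq_0:
  assumes "feasible n a" "n \<ge> 1"
  shows "(\<Sum>i=2..n. hat n a i) = 0"
  using sum_hat_eq[OF assms(1), of n] assms by (simp add: feasible_def)

definition slack :: "nat \<Rightarrow> (nat \<Rightarrow> int) \<Rightarrow> nat \<Rightarrow> int" where
  "slack n c k = (int k - 1) * (int n - int k) - (\<Sum>i=2..k. c i)"

lemma slack_strictly_concave_iff:
  assumes "k \<ge> 2"
  shows "slack n c (Suc k) - slack n c k < slack n c k - slack n c (k - 1) \<longleftrightarrow>
    c k < c (Suc k) + 2"
proof -
  obtain l where "k = Suc l" "l \<ge> 1" using assms by (cases k) auto
  then show ?thesis by (simp add: slack_def algebra_simps)
qed

lemma slack_hat_nonneg_if_increased_subset: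
  assumes "feasible n a" "k \<in> {1..n}" "increased n a \<subseteq> {k<..n}"
  shows "0 \<le> slack n (hat n a) k"
proof -
  have "a 1 = int (card (increased n a))"
    using card_increased[OF assms(1)] assms(2) by simp
  also have "\<dots> \<le> int (card {k<..n})"
    using card_mono[OF _ assms(3)] by simp
  also have "\<dots> = int n - int k"
    using assms(2) by (simp add: of_nat_diff)
  finally have first_le: "a 1 \<le> int n - int k" .
  have "(\<Sum>i=2..k. hat n a i) = (\<Sum>i=2..k. a i)"
    using assms(3) by (intro sum.cong) (auto simp: hat_def)
  also have "\<dots> \<le> of_nat (card {2..k}) * a 1"
    using assms(2) by (intro sum_bounded_above feasible_le_first[OF assms(1)]) auto
  also have "\<dots> = (int k - 1) * a 1"
    using assms(2) by simp
  also have "\<dots> \<le> (int k - 1) * (int n - int k)"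
    using assms(2) first_le by (intro mult_left_mono) auto
  finally show ?thesis by (simp add: slack_def)
qed

lemma slack_hat_nonneg_if_subset_increased:
  assumes "feasible n a" "k \<in> {1..n}" "{k<..n} \<subseteq> increased n a"
  shows "0 \<le> slack n (hat n a) k"
proof -
  have "(\<Sum>i=2..k. hat n a i) = (\<Sum>i=1..k. a i) - (int n - int k)"
    using sum_hat_eq[OF assms(1,2)] assms(2,3) by (simp add: Int_absorb1)
  also have "\<dots> \<le> int k * (int n - int k) - (int n - int k)"
    using assms(1,2) unfolding feasible_def by auto
  finally show ?thesis by (simp add: slack_def algebra_simps)
qed

lemma hat_drop_le_1:
  assumes "antimono_on {2..n} a"
    and "i \<in> increased n a" "i \<le> k" "j \<in> {k<..n} - increased n a"
  shows "hat n a k \<le> hat n a (Suc k) + 1"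
proof -
  have "2 \<le> i" using assms(2) by (simp add: smallest_def)
  then have "a k = a i" "a (Suc k) = a i"
    using assms(3,4) by (auto intro!: antimono_on_constant_between_smallest[OF _ assms(1,2), of j])
  then show ?thesis by (simp add: hat_def)
qed

lemma slack_hat_nonneg:
  assumes "feasible n a" "k \<in> {1..n}"
  shows "0 \<le> slack n (hat n a) k"
proof (rule nonneg_if_strictly_concave_where_neg[OF _ assms(2)])
  fix k assume k: "k \<in> {1..n}" and neg: "slack n (hat n a) k < 0"
  have "\<not> increased n a \<subseteq> {k<..n}" "\<not> {k<..n} \<subseteq> increased n a"
    using slack_hat_nonneg_if_increased_subset[OF assms(1) k]
      slack_hat_nonneg_if_subset_increased[OF assms(1) k] neg by auto
  then obtain i j where i: "i \<in> increased n a" "i \<notin> {k<..n}"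
      and j: "j \<in> {k<..n} - increased n a"
    by blast
  have "2 \<le> i" "i \<le> k" using i by (auto simp: smallest_def)
  have "hat n a k \<le> hat n a (Suc k) + 1"
    using hat_drop_le_1[OF feasible_antimono_on_tail[OF assms(1)] i(1) \<open>i \<le> k\<close> j] .
  then show "1 < k \<and> k < n \<and> slack n (hat n a) (Suc k) - slack n (hat n a) k
      < slack n (hat n a) k - slack n (hat n a) (k - 1)"
    using slack_strictly_concave_iff[of k n "hat n a"] \<open>2 \<le> i\<close> \<open>i \<le> k\<close> j by auto
qed

theorem theorem3:
  fixes n :: nat and a :: "nat \<Rightarrow> int"
  assumes "n \<ge> 1"
    and "feasible n a"
  shows "0 \<le> a 1 \<and> a 1 \<le> int n - 1 \<and>
         feasible (n - 1) (\<lambda>i. hat n a (i + 1)) \<and>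
         antimono_on {2..n} (hat n a) \<and>
         (\<Sum>i=2..n. hat n a i) = 0 \<and>
         (\<forall>k\<in>{2..n}. (\<Sum>i=2..k. hat n a i) \<le> (int k - 1) * (int n - int k))"
proof -
  have bound: "(\<Sum>i=2..k. hat n a i) \<le> (int k - 1) * (int n - int k)" if "k \<in> {2..n}" for k
    using slack_hat_nonneg[OF assms(2), of k] that by (simp add: slack_def)
  have "feasible (n - 1) (\<lambda>i. hat n a (i + 1))"
    unfolding feasible_shift_iff[OF assms(1)]
    using antimono_on_hat[OF assms(2)] sum_hat_eq_0[OF assms(2,1)] bound by blast
  then show ?thesis
    using feasible_first_nonneg[OF assms(2,1)] feasible_first_le[OF assms(2,1)]
    by (simp only: feasible_shift_iff[OF assms(1)]) blast
qed

end
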